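(* The hyper swap structure construction provides a (Kalman) functor $\mathsf S:\mathbf{IHL}\to\mathbf{HC}_\omega\mathbf{A}$, given on objects by $\mathsf L\mapsto\mathsf S(\mathsf L)$ and on morphisms $f:\mathsf L_1\to\mathsf L_2$ by $\mathsf S(f)(z_1,z_2)=(f(z_1),f(z_2))$.
   Context: Prosets: a proset is a non-empty set $P$ with a reflexive transitive relation $\preceq$. Write $x\equiv y$ if $x\preceq y$ and $y\preceq x$. For $A,B\subseteq P$: $A\preceq B$ means $a\preceq b$ for all $a\in A,b\in B$ (similarly with an element in place of a set); $A\equiv B$ means $a\equiv b$ for all $a\in A,b\in B$. $\mathsf{Min}(B)=\{x\in B: x\preceq B\}$, $\mathsf{Max}(B)=\{x\in B: B\preceq x\}$; $\mathsf{Ub}(B)$, $\mathsf{Lb}(B)$ are the sets of upper and lower bounds of $B$ in $P$; $\top=\mathsf{Max}(P)$. Hyperoperations: an $n$-ary hyperoperation on $A$ is a map $A^n\to\wp(A)\setminus\{\emptyset\}$; a hyperalgebra over a signature is a set with a hyperoperation for each symbol. Hyperlattice: a proset in which $x\curlyvee y:=\mathsf{Min}(\mathsf{Ub}(\{x,y\}))$ and $x\curlywedge y:=\mathsf{Max}(\mathsf{Lb}(\{x,y\}))$ are non-empty for all $x,y$. A Sette implicative hyperlattice (IHL) is a hyperalgebra $\mathsf L=\langle L,\curlywedge,\curlyvee,\multimap\rangle$ such that $\langle L,\curlywedge,\curlyvee\rangle$ is a hyperlattice and, for all $x,y,z,z'$: $z\in x\multimap y$ implies $x\curlywedge z\preceq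 y$; $x\curlywedge z\preceq y$ implies $z\preceq x\multimap y$; $z\equiv z'$ and $z\in x\multimap y$ imply $z'\in x\multimap y$. HC$_\omega$A (hyper $C_\omega$ algebra): a hyperalgebra $\mathsf H=\langle H,\curlywedge,\curlyvee,\multimap,\div\rangle$ ($\div$ unary) whose reduct $\langle H,\curlywedge,\curlyvee,\multimap\rangle$ is an IHL and such that for all $x,y,w$: if $y\in\div x$ and $w\in x\curlyvee y$ then $w\in\top$; if $y\in\div x$ and $w\in\div y$ then $w\preceq x$. Categories: $\mathbf{IHL}$ has IHLs as objects; a morphism $f:\mathsf L_1\to\mathsf L_2$ is a function $L_1\to L_2$ such that $z\in x\,\#\,y$ implies $f(z)\in f(x)\,\#\,f(y)$ for each $\#\in\{\curlywedge,\curlyvee,\multimap\}$. $\mathbf{HC}_\omega\mathbf{A}$ has HC$_\omega$As as objects; morphisms are functions satisfying the same conditions and, in addition, $z\in\div x$ implies $f(z)\in\div f(x)$. Hyper swap structures: for an IHL $\mathsf L$, let $S^{C_\omega}_{\mathsf L}=\{z=(z_1,z_2)\in L\times L: z_1\curlyvee z_2\equiv\top\}$, and let $\mathsf S(\mathsf L)$ be the hyperalgebra with domain $S^{C_\omega}_{\mathsf L}$ and $z\curlywedge w=\{u: u_1\in z_1\curlywedge w_1\}$, $z\curlyvee w=\{u: u_1\in z_1\curlyvee w_1\}$, $z\multimap w=\{u: u_1\in z_1\multimap w_1\}$, $\div z=\{u: u_1=z_2\text{ and }u_2\preceq z_1\}$ ($u$ ranging over $S^{C_\omega}_{\mathsf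 L}$), with preorder $z\preceq w$ iff $z_1\preceq w_1$ in $\mathsf L$. *)

theory Defs
  imports Main "HOL-Library.FuncSet"
begin

section \<open>Prosets\<close>

text \<open>The preorder is part of the data, as a relation contained in the square of the carrier
  (this containment is part of \<^const>\<open>preorder_on\<close>).\<close>

record 'a proset =
  carrier :: "'a set"
  preord :: "'a rel"

definition proset :: "('a, 'x) proset_scheme \<Rightarrow> bool" where
  "proset P \<longleftrightarrow> carrier P \<noteq> {} \<and> preorder_on (carrier P) (preord P)"

definition le :: "('a, 'x) proset_scheme \<Rightarrow> 'a \<Rightarrow> 'a \<Rightarrow> bool" (infix "\<preceq>\<index>" 50) where
  "x \<preceq>\<^bsub>P\<^esub> y \<longleftrightarrow> (x, y) \<in> preord P"

definition eqv :: "('a, 'x) proset_scheme \<Rightarrow> 'a \<Rightarrow> 'a \<Rightarrow> bool" (infix "\<approx>\<index>" 50) where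
  "x \<approx>\<^bsub>P\<^esub> y \<longleftrightarrow> x \<preceq>\<^bsub>P\<^esub> y \<and> y \<preceq>\<^bsub>P\<^esub> x"

definition set_le :: "('a, 'x) proset_scheme \<Rightarrow> 'a set \<Rightarrow> 'a set \<Rightarrow> bool" where
  "set_le P A B \<longleftrightarrow> (\<forall>a\<in>A. \<forall>b\<in>B. a \<preceq>\<^bsub>P\<^esub> b)"

definition set_eqv :: "('a, 'x) proset_scheme \<Rightarrow> 'a set \<Rightarrow> 'a set \<Rightarrow> bool" where
  "set_eqv P A B \<longleftrightarrow> (\<forall>a\<in>A. \<forall>b\<in>B. a \<approx>\<^bsub>P\<^esub> b)"

definition Mins :: "('a, 'x) proset_scheme \<Rightarrow> 'a set \<Rightarrow> 'a set" where
  "Mins P B = {x \<in> B. set_le P {x} B}"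

definition Maxs :: "('a, 'x) proset_scheme \<Rightarrow> 'a set \<Rightarrow> 'a set" where
  "Maxs P B = {x \<in> B. set_le P B {x}}"

definition Ub :: "('a, 'x) proset_scheme \<Rightarrow> 'a set \<Rightarrow> 'a set" where
  "Ub P B = {x \<in> carrier P. set_le P B {x}}"

definition Lb :: "('a, 'x) proset_scheme \<Rightarrow> 'a set \<Rightarrow> 'a set" where
  "Lb P B = {x \<in> carrier P. set_le P {x} B}"

definition Top :: "('a, 'x) proset_scheme \<Rightarrow> 'a set" where
  "Top P = Maxs P (carrier P)"

section \<open>Hyperalgebras\<close>

text \<open>Hyperoperations are extensional functions, so that a structure is determined by its
  values on the carrier.\<close>

definition hyperop1 :: "'a set \<Rightarrow> ('a \<Rightarrow> 'a set) \<Rightarrow> bool" where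
  "hyperop1 A h \<longleftrightarrow> h \<in> A \<rightarrow>\<^sub>E (Pow A - {{}})"

definition hyperop2 :: "'a set \<Rightarrow> ('a \<Rightarrow> 'a \<Rightarrow> 'a set) \<Rightarrow> bool" where
  "hyperop2 A h \<longleftrightarrow> h \<in> A \<rightarrow>\<^sub>E A \<rightarrow>\<^sub>E (Pow A - {{}})"

record 'a hyperlattice = "'a proset" +
  meet :: "'a \<Rightarrow> 'a \<Rightarrow> 'a set"
  join :: "'a \<Rightarrow> 'a \<Rightarrow> 'a set"

record 'a ihl = "'a hyperlattice" +
  imp :: "'a \<Rightarrow> 'a \<Rightarrow> 'a set"

record 'a hcw = "'a ihl" +
  neg :: "'a \<Rightarrow> 'a set"

text \<open>The required non-emptiness of meets and joins is part of \<^const>\<open>hyperop2\<close>. The preorder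
  is determined by the operations, since \<open>x \<preceq> y\<close> iff \<open>x\<close> belongs to \<open>meet x y\<close>; keeping it as a
  field therefore adds no structure.\<close>

definition hyperlattice :: "('a, 'x) hyperlattice_scheme \<Rightarrow> bool" where
  "hyperlattice L \<longleftrightarrow>
     proset L \<and> hyperop2 (carrier L) (meet L) \<and> hyperop2 (carrier L) (join L) \<and>
     (\<forall>x\<in>carrier L. \<forall>y\<in>carrier L.
        join L x y = Mins L (Ub L {x, y}) \<and> meet L x y = Maxs L (Lb L {x, y}))"

definition is_ihl :: "('a, 'x) ihl_scheme \<Rightarrow> bool" where
  "is_ihl L \<longleftrightarrow>
     hyperlattice L \<and> hyperop2 (carrier L) (imp L) \<and>
     (\<forall>x\<in>carrier L. \<forall>y\<in>carrier L. \<forall>z\<in>carrier L.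
        z \<in> imp L x y \<longrightarrow> set_le L (meet L x z) {y}) \<and>
     (\<forall>x\<in>carrier L. \<forall>y\<in>carrier L. \<forall>z\<in>carrier L.
        set_le L (meet L x z) {y} \<longrightarrow> set_le L {z} (imp L x y)) \<and>
     (\<forall>x\<in>carrier L. \<forall>y\<in>carrier L. \<forall>z\<in>carrier L. \<forall>z'\<in>carrier L.
        z \<approx>\<^bsub>L\<^esub> z' \<and> z \<in> imp L x y \<longrightarrow> z' \<in> imp L x y)"

definition is_hcw :: "('a, 'x) hcw_scheme \<Rightarrow> bool" where
  "is_hcw H \<longleftrightarrow>
     is_ihl H \<and> hyperop1 (carrier H) (neg H) \<and>
     (\<forall>x\<in>carrier H. \<forall>y\<in>carrier H. \<forall>w\<in>carrier H.
        y \<in> neg H x \<and> w \<in> join H x y \<longrightarrow> w \<in> Top H) \<and>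
     (\<forall>x\<in>carrier H. \<forall>y\<in>carrier H. \<forall>w\<in>carrier H.
        y \<in> neg H x \<and> w \<in> neg H y \<longrightarrow> w \<preceq>\<^bsub>H\<^esub> x)"

section \<open>Categories and functors\<close>

text \<open>Categories are given by hom-sets; identities, composition and the morphism part of a functor
  take the objects involved as arguments, because an extensional function does not
  by itself determine its domain and codomain. \<open>comp C X Y Z g f\<close> is \<open>g\<close> after \<open>f\<close>
  for \<open>f : X \<rightarrow> Y\<close> and \<open>g : Y \<rightarrow> Z\<close>.\<close>

record ('o, 'm) cat =
  obj :: "'o set"
  hom :: "'o \<Rightarrow> 'o \<Rightarrow> 'm set"
  ident :: "'o \<Rightarrow> 'm"
  comp :: "'o \<Rightarrow> 'o \<Rightarrow> 'o \<Rightarrow> 'm \<Rightarrow> 'm \<Rightarrow> 'm"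

locale category =
  fixes C :: "('o, 'm) cat"
  assumes ident_hom: "X \<in> obj C \<Longrightarrow> ident C X \<in> hom C X X"
    and comp_hom: "\<lbrakk>X \<in> obj C; Y \<in> obj C; Z \<in> obj C; f \<in> hom C X Y; g \<in> hom C Y Z\<rbrakk>
      \<Longrightarrow> comp C X Y Z g f \<in> hom C X Z"
    and comp_ident_right: "\<lbrakk>X \<in> obj C; Y \<in> obj C; f \<in> hom C X Y\<rbrakk>
      \<Longrightarrow> comp C X X Y f (ident C X) = f"
    and comp_ident_left: "\<lbrakk>X \<in> obj C; Y \<in> obj C; f \<in> hom C X Y\<rbrakk>
      \<Longrightarrow> comp C X Y Y (ident C Y) f = f"
    and comp_assoc: "\<lbrakk>W \<in> obj C; X \<in> obj C; Y \<in> obj C; Z \<in> obj C;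
        f \<in> hom C W X; g \<in> hom C X Y; h \<in> hom C Y Z\<rbrakk>
      \<Longrightarrow> comp C W Y Z h (comp C W X Y g f) = comp C W X Z (comp C X Y Z h g) f"

locale cat_functor = dom: category C + cod: category D
  for C :: "('o, 'm) cat" and D :: "('p, 'n) cat" +
  fixes Fobj :: "'o \<Rightarrow> 'p" and Fmap :: "'o \<Rightarrow> 'o \<Rightarrow> 'm \<Rightarrow> 'n"
  assumes Fobj_obj: "X \<in> obj C \<Longrightarrow> Fobj X \<in> obj D"
    and Fmap_hom: "\<lbrakk>X \<in> obj C; Y \<in> obj C; f \<in> hom C X Y\<rbrakk>
      \<Longrightarrow> Fmap X Y f \<in> hom D (Fobj X) (Fobj Y)"
    and Fmap_ident: "X \<in> obj C \<Longrightarrow> Fmap X X (ident C X) = ident D (Fobj X)"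
    and Fmap_comp: "\<lbrakk>X \<in> obj C; Y \<in> obj C; Z \<in> obj C; f \<in> hom C X Y; g \<in> hom C Y Z\<rbrakk>
      \<Longrightarrow> Fmap X Z (comp C X Y Z g f)
        = comp D (Fobj X) (Fobj Y) (Fobj Z) (Fmap Y Z g) (Fmap X Y f)"

section \<open>The categories of IHLs and of hyper \<open>C\<^sub>\<omega>\<close> algebras\<close>

definition ihl_hom :: "('a, 'x) ihl_scheme \<Rightarrow> ('b, 'y) ihl_scheme \<Rightarrow> ('a \<Rightarrow> 'b) set" where
  "ihl_hom L M = {f \<in> carrier L \<rightarrow>\<^sub>E carrier M.
     \<forall>x\<in>carrier L. \<forall>y\<in>carrier L. \<forall>z\<in>carrier L.
       (z \<in> meet L x y \<longrightarrow> f z \<in> meet M (f x) (f y)) \<and>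
       (z \<in> join L x y \<longrightarrow> f z \<in> join M (f x) (f y)) \<and>
       (z \<in> imp L x y \<longrightarrow> f z \<in> imp M (f x) (f y))}"

definition hcw_hom :: "('a, 'x) hcw_scheme \<Rightarrow> ('b, 'y) hcw_scheme \<Rightarrow> ('a \<Rightarrow> 'b) set" where
  "hcw_hom H K = {f \<in> ihl_hom H K.
     \<forall>x\<in>carrier H. \<forall>z\<in>carrier H. z \<in> neg H x \<longrightarrow> f z \<in> neg K (f x)}"

definition IHL :: "('a ihl, 'a \<Rightarrow> 'a) cat" where
  "IHL = \<lparr>obj = {L. is_ihl L}, hom = ihl_hom,
     ident = (\<lambda>L. \<lambda>x\<in>carrier L. x),
     comp = (\<lambda>L M N g f. compose (carrier L) g f)\<rparr>"

definition HCwA :: "('a hcw, 'a \<Rightarrow> 'a) cat" where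
  "HCwA = \<lparr>obj = {H. is_hcw H}, hom = hcw_hom,
     ident = (\<lambda>H. \<lambda>x\<in>carrier H. x),
     comp = (\<lambda>H K M g f. compose (carrier H) g f)\<rparr>"

section \<open>Hyper swap structures\<close>

definition swap_carrier :: "('a, 'x) ihl_scheme \<Rightarrow> ('a \<times> 'a) set" where
  "swap_carrier L =
     {z \<in> carrier L \<times> carrier L. set_eqv L (join L (fst z) (snd z)) (Top L)}"

definition swap_obj :: "('a, 'x) ihl_scheme \<Rightarrow> ('a \<times> 'a) hcw" where
  "swap_obj L = \<lparr>
     carrier = swap_carrier L,
     preord = {(z, w). z \<in> swap_carrier L \<and> w \<in> swap_carrier L \<and> fst z \<preceq>\<^bsub>L\<^esub> fst w},
     meet = (\<lambda>z\<in>swap_carrier L. \<lambda>w\<in>swap_carrier L.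
       {u \<in> swap_carrier L. fst u \<in> meet L (fst z) (fst w)}),
     join = (\<lambda>z\<in>swap_carrier L. \<lambda>w\<in>swap_carrier L.
       {u \<in> swap_carrier L. fst u \<in> join L (fst z) (fst w)}),
     imp = (\<lambda>z\<in>swap_carrier L. \<lambda>w\<in>swap_carrier L.
       {u \<in> swap_carrier L. fst u \<in> imp L (fst z) (fst w)}),
     neg = (\<lambda>z\<in>swap_carrier L.
       {u \<in> swap_carrier L. fst u = snd z \<and> snd u \<preceq>\<^bsub>L\<^esub> fst z})\<rparr>"

definition swap_map ::
    "('a, 'x) ihl_scheme \<Rightarrow> ('b, 'y) ihl_scheme \<Rightarrow> ('a \<Rightarrow> 'b) \<Rightarrow> 'a \<times> 'a \<Rightarrow> 'b \<times> 'b" where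
  "swap_map L M f = (\<lambda>z\<in>swap_carrier L. (f (fst z), f (snd z)))"

end

theory Submission imports Defs begin

text \<open>The first projection of the swap structure onto \<open>L\<close> is surjective, because \<open>(x, t)\<close> belongs
  to it for every \<open>t\<close> in \<open>\<top>\<close>; it also preserves and reflects the preorder. Hence bounds, minima
  and maxima in the swap structure are computed in the first coordinate, and the IHL axioms lift.
  A morphism \<open>f\<close> of IHLs is monotone since \<open>x \<preceq> y\<close> iff \<open>x\<close> belongs to the meet of \<open>x\<close> and \<open>y\<close>,
  and it preserves \<open>\<top>\<close> since \<open>\<top>\<close> is the implication from \<open>x\<close> to itself. Together with the
  preservation of joins this shows that \<open>f \<times> f\<close> maps swap structures to swap structures.\<close>

section \<open>Implicative hyperlattices\<close>

lemma hyperop2D: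
  assumes "hyperop2 A h" "x \<in> A" "y \<in> A"
  shows "h x y \<subseteq> A" "h x y \<noteq> {}"
proof -
  have "h x \<in> A \<rightarrow>\<^sub>E (Pow A - {{}})"
    using assms(1,2) unfolding hyperop2_def by (rule PiE_mem)
  from PiE_mem[OF this assms(3)] show "h x y \<subseteq> A" "h x y \<noteq> {}" by auto
qed

context
  fixes L :: "('a, 'x) ihl_scheme"
  assumes ihl: "is_ihl L"
begin

lemma le_carrier:
  assumes "x \<preceq>\<^bsub>L\<^esub> y"
  shows "x \<in> carrier L" "y \<in> carrier L"
  using ihl assms unfolding is_ihl_def hyperlattice_def proset_def preorder_on_def le_def by auto

lemma le_refl: "x \<in> carrier L \<Longrightarrow> x \<preceq>\<^bsub>L\<^esub> x"
  using ihl unfolding is_ihl_def hyperlattice_def proset_def preorder_on_def refl_on_def le_def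
  by auto

lemma le_trans: "x \<preceq>\<^bsub>L\<^esub> y \<Longrightarrow> y \<preceq>\<^bsub>L\<^esub> z \<Longrightarrow> x \<preceq>\<^bsub>L\<^esub> z"
  using ihl unfolding is_ihl_def hyperlattice_def proset_def preorder_on_def le_def
  by (meson transD)

lemma carrier_nonempty: "carrier L \<noteq> {}"
  using ihl unfolding is_ihl_def hyperlattice_def proset_def by auto

lemma hyperop_closed:
  assumes "x \<in> carrier L" "y \<in> carrier L"
  shows "meet L x y \<subseteq> carrier L" "join L x y \<subseteq> carrier L" "imp L x y \<subseteq> carrier L"
  using ihl hyperop2D[OF _ assms] unfolding is_ihl_def hyperlattice_def by blast+

lemma hyperop_nonempty:
  assumes "x \<in> carrier L" "y \<in> carrier L"
  shows "meet L x y \<noteq> {}" "join L x y \<noteq> {}" "imp L x y \<noteq> {}"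
  using ihl hyperop2D[OF _ assms] unfolding is_ihl_def hyperlattice_def by blast+

text \<open>The bound variable \<open>v\<close> may range over the whole type because the preorder
  relates only elements of the carrier.\<close>

lemma mem_meet_iff:
  assumes "x \<in> carrier L" "y \<in> carrier L"
  shows "z \<in> meet L x y \<longleftrightarrow> z \<preceq>\<^bsub>L\<^esub> x \<and> z \<preceq>\<^bsub>L\<^esub> y \<and> (\<forall>v. v \<preceq>\<^bsub>L\<^esub> x \<and> v \<preceq>\<^bsub>L\<^esub> y \<longrightarrow> v \<preceq>\<^bsub>L\<^esub> z)"
proof -
  have "meet L x y = Maxs L (Lb L {x, y})"
    using ihl assms unfolding is_ihl_def hyperlattice_def by blast
  then show ?thesis
    by (auto simp: Maxs_def Lb_def set_le_def dest: le_carrier)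
qed

lemma mem_join_iff:
  assumes "x \<in> carrier L" "y \<in> carrier L"
  shows "z \<in> join L x y \<longleftrightarrow> x \<preceq>\<^bsub>L\<^esub> z \<and> y \<preceq>\<^bsub>L\<^esub> z \<and> (\<forall>v. x \<preceq>\<^bsub>L\<^esub> v \<and> y \<preceq>\<^bsub>L\<^esub> v \<longrightarrow> z \<preceq>\<^bsub>L\<^esub> v)"
proof -
  have "join L x y = Mins L (Ub L {x, y})"
    using ihl assms unfolding is_ihl_def hyperlattice_def by blast
  then show ?thesis
    by (auto simp: Mins_def Ub_def set_le_def dest: le_carrier)
qed

lemma imp_elim: "\<lbrakk>x \<in> carrier L; y \<in> carrier L; z \<in> imp L x y; v \<in> meet L x z\<rbrakk> \<Longrightarrow> v \<preceq>\<^bsub>L\<^esub> y"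
  using ihl hyperop_closed(3) unfolding is_ihl_def set_le_def by blast

lemma imp_greatest:
  "\<lbrakk>x \<in> carrier L; y \<in> carrier L; z \<in> carrier L; \<And>v. v \<in> meet L x z \<Longrightarrow> v \<preceq>\<^bsub>L\<^esub> y; w \<in> imp L x y\<rbrakk>
    \<Longrightarrow> z \<preceq>\<^bsub>L\<^esub> w"
  using ihl unfolding is_ihl_def set_le_def by blast

lemma imp_eqv_closed:
  "\<lbrakk>x \<in> carrier L; y \<in> carrier L; z \<in> imp L x y; z \<preceq>\<^bsub>L\<^esub> z'; z' \<preceq>\<^bsub>L\<^esub> z\<rbrakk> \<Longrightarrow> z' \<in> imp L x y"
  using ihl le_carrier unfolding is_ihl_def eqv_def by blast

section \<open>Top elements and the domain of the swap structure\<close>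

lemma mem_Top_iff: "t \<in> Top L \<longleftrightarrow> t \<in> carrier L \<and> (\<forall>x\<in>carrier L. x \<preceq>\<^bsub>L\<^esub> t)"
  by (auto simp: Top_def Maxs_def set_le_def)

text \<open>Every meet of \<open>x\<close> with any element lies below \<open>x\<close>, so every
  element lies below all of \<open>imp L x x\<close>. Conversely, top elements are equivalent to
  each other, and implications are closed under equivalence.\<close>

lemma imp_self_eq_Top:
  assumes x: "x \<in> carrier L"
  shows "imp L x x = Top L"
proof -
  have sub: "imp L x x \<subseteq> Top L"
    using x imp_greatest[OF x x] hyperop_closed(3)[OF x x] by (auto simp: mem_Top_iff mem_meet_iff)
  obtain z where z: "z \<in> imp L x x" using hyperop_nonempty(3)[OF x x] by auto
  have "t \<in> imp L x x" if "t \<in> Top L" for t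
    using imp_eqv_closed[OF x x z] that sub z by (auto simp: mem_Top_iff)
  then show ?thesis using sub by blast
qed

lemma Top_nonempty: "Top L \<noteq> {}"
  using carrier_nonempty imp_self_eq_Top hyperop_nonempty(3) by (metis ex_in_conv)

lemma le_iff_mem_meet:
  "\<lbrakk>x \<in> carrier L; y \<in> carrier L\<rbrakk> \<Longrightarrow> x \<preceq>\<^bsub>L\<^esub> y \<longleftrightarrow> x \<in> meet L x y"
  by (auto simp: mem_meet_iff le_refl)

text \<open>An element of the carrier equivalent to one top element is itself top, so equivalence
  with \<open>Top L\<close> becomes inclusion. This relies on \<open>Top L\<close> being non-empty,
  as \<open>set_eqv\<close> would otherwise hold vacuously.\<close>

lemma mem_swap_carrier_iff:
  "z \<in> swap_carrier L \<longleftrightarrow>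
    fst z \<in> carrier L \<and> snd z \<in> carrier L \<and> join L (fst z) (snd z) \<subseteq> Top L"
proof -
  obtain t where t: "t \<in> Top L" using Top_nonempty by auto
  have "set_eqv L A (Top L) \<longleftrightarrow> A \<subseteq> Top L" if A: "A \<subseteq> carrier L" for A
  proof
    assume "set_eqv L A (Top L)"
    then have "t \<preceq>\<^bsub>L\<^esub> a" if "a \<in> A" for a
      using t that by (simp add: set_eqv_def eqv_def)
    then show "A \<subseteq> Top L"
      using A t le_trans unfolding mem_Top_iff subset_iff by metis
  next
    assume "A \<subseteq> Top L"
    then show "set_eqv L A (Top L)"
      by (auto simp: set_eqv_def eqv_def mem_Top_iff subset_iff)
  qed
  then show ?thesis
    using hyperop_closed(2) by (auto simp: swap_carrier_def mem_Times_iff)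
qed

text \<open>The elements of a join are mutually equivalent, so a single top element among them makes
  all of them top. Membership in the swap structure thus needs just one witness.\<close>

lemma swap_carrier_of_join_meets_Top:
  assumes "x \<in> carrier L" "y \<in> carrier L" "w \<in> join L x y" "w \<in> Top L"
  shows "(x, y) \<in> swap_carrier L"
proof -
  have "v \<in> Top L" if v: "v \<in> join L x y" for v
  proof -
    have "w \<preceq>\<^bsub>L\<^esub> v" using v assms by (simp add: mem_join_iff)
    then show ?thesis using assms(4) le_carrier le_trans unfolding mem_Top_iff by metis
  qed
  then show ?thesis using assms by (auto simp: mem_swap_carrier_iff)
qed

lemma Pair_Top_mem_swap_carrier:
  assumes "x \<in> carrier L" "t \<in> Top L"
  shows "(x, t) \<in> swap_carrier L"
  using assms by (intro swap_carrier_of_join_meets_Top[of _ _ t])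
    (auto simp: mem_Top_iff mem_join_iff)

text \<open>The characterization of joins by upper bounds is symmetric. The exchanged pair will
  witness that negations are non-empty.\<close>

lemma swap_mem_swap_carrier:
  assumes "z \<in> swap_carrier L"
  shows "(snd z, fst z) \<in> swap_carrier L"
  using assms by (auto simp: mem_swap_carrier_iff mem_join_iff subset_iff)

lemma fst_swap_carrier: "fst ` swap_carrier L = carrier L"
proof -
  obtain t where "t \<in> Top L" using Top_nonempty by auto
  then have "x \<in> fst ` swap_carrier L" if "x \<in> carrier L" for x
    using Pair_Top_mem_swap_carrier[OF that] by force
  then show ?thesis by (auto simp: mem_swap_carrier_iff)
qed

lemma ex_swap_carrier_fst: "x \<in> carrier L \<Longrightarrow> \<exists>z\<in>swap_carrier L. fst z = x"
  using fst_swap_carrier by (metis imageE)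

section \<open>The hyper swap structure\<close>

lemma le_swap_obj_iff:
  "z \<preceq>\<^bsub>swap_obj L\<^esub> w \<longleftrightarrow> z \<in> swap_carrier L \<and> w \<in> swap_carrier L \<and> fst z \<preceq>\<^bsub>L\<^esub> fst w"
  by (auto simp: swap_obj_def le_def)

lemma swap_obj_simps:
  "carrier (swap_obj L) = swap_carrier L"
  "\<lbrakk>z \<in> swap_carrier L; w \<in> swap_carrier L\<rbrakk> \<Longrightarrow>
    meet (swap_obj L) z w = {u \<in> swap_carrier L. fst u \<in> meet L (fst z) (fst w)}"
  "\<lbrakk>z \<in> swap_carrier L; w \<in> swap_carrier L\<rbrakk> \<Longrightarrow>
    join (swap_obj L) z w = {u \<in> swap_carrier L. fst u \<in> join L (fst z) (fst w)}"
  "\<lbrakk>z \<in> swap_carrier L; w \<in> swap_carrier L\<rbrakk> \<Longrightarrow>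
    imp (swap_obj L) z w = {u \<in> swap_carrier L. fst u \<in> imp L (fst z) (fst w)}"
  "z \<in> swap_carrier L \<Longrightarrow>
    neg (swap_obj L) z = {u \<in> swap_carrier L. fst u = snd z \<and> snd u \<preceq>\<^bsub>L\<^esub> fst z}"
  by (auto simp: swap_obj_def)

lemma fst_mem_carrier: "z \<in> swap_carrier L \<Longrightarrow> fst z \<in> carrier L"
  by (simp add: mem_swap_carrier_iff)

text \<open>Values are non-empty because the first projection is onto \<open>carrier L\<close>.
  Leaving \<open>h\<close> arbitrary covers meet, join and implication at once.\<close>

lemma hyperop2_fst_preimage:
  assumes h: "\<And>x y. \<lbrakk>x \<in> carrier L; y \<in> carrier L\<rbrakk> \<Longrightarrow> h x y \<subseteq> carrier L \<and> h x y \<noteq> {}"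
  shows "hyperop2 (swap_carrier L)
    (\<lambda>z\<in>swap_carrier L. \<lambda>w\<in>swap_carrier L. {u \<in> swap_carrier L. fst u \<in> h (fst z) (fst w)})"
proof -
  have "{u \<in> swap_carrier L. fst u \<in> h (fst z) (fst w)} \<noteq> {}"
    if "z \<in> swap_carrier L" "w \<in> swap_carrier L" for z w
  proof -
    from h[OF that[THEN fst_mem_carrier]] obtain x where "x \<in> h (fst z) (fst w)" "x \<in> carrier L"
      by blast
    then show ?thesis using ex_swap_carrier_fst by blast
  qed
  then show ?thesis unfolding hyperop2_def by (intro restrict_PiE_iff[THEN iffD2] ballI) blast
qed

lemma swap_obj_hyperlattice: "hyperlattice (swap_obj L)"
proof -
  let ?S = "swap_obj L"
  have "swap_carrier L \<noteq> {}" using fst_swap_carrier carrier_nonempty by auto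
  then have "proset ?S"
    by (auto simp: proset_def preorder_on_def swap_obj_def refl_on_def fst_mem_carrier le_refl
        intro!: transI intro: le_trans)
  moreover have "hyperop2 (carrier ?S) (meet ?S)" "hyperop2 (carrier ?S) (join ?S)"
    using hyperop2_fst_preimage[of "meet L"] hyperop2_fst_preimage[of "join L"]
      hyperop_closed hyperop_nonempty by (simp_all add: swap_obj_def)
  moreover have "join ?S z w = Mins ?S (Ub ?S {z, w}) \<and> meet ?S z w = Maxs ?S (Lb ?S {z, w})"
    if "z \<in> swap_carrier L" "w \<in> swap_carrier L" for z w
  proof
    note c = that[THEN fst_mem_carrier]
    have "Mins ?S (Ub ?S {z, w}) = {u \<in> swap_carrier L. fst z \<preceq>\<^bsub>L\<^esub> fst u \<and> fst w \<preceq>\<^bsub>L\<^esub> fst u \<and>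
        (\<forall>v\<in>swap_carrier L. fst z \<preceq>\<^bsub>L\<^esub> fst v \<and> fst w \<preceq>\<^bsub>L\<^esub> fst v \<longrightarrow> fst u \<preceq>\<^bsub>L\<^esub> fst v)}"
      using that by (simp add: Mins_def Ub_def set_le_def le_swap_obj_iff swap_obj_simps
          del: split_paired_All) blast
    also have "\<dots> = {u \<in> swap_carrier L. fst u \<in> join L (fst z) (fst w)}"
    proof -
      \<comment> \<open>By surjectivity of the first projection, testing against first coordinates
        of pairs is the same as testing against all elements of \<open>L\<close>.\<close>
      have "(\<forall>v\<in>swap_carrier L. fst z \<preceq>\<^bsub>L\<^esub> fst v \<and> fst w \<preceq>\<^bsub>L\<^esub> fst v \<longrightarrow> a \<preceq>\<^bsub>L\<^esub> fst v) \<longleftrightarrow>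
          (\<forall>v. fst z \<preceq>\<^bsub>L\<^esub> v \<and> fst w \<preceq>\<^bsub>L\<^esub> v \<longrightarrow> a \<preceq>\<^bsub>L\<^esub> v)" for a
        using ex_swap_carrier_fst le_carrier(2) by metis
      then show ?thesis by (simp only: mem_join_iff[OF c])
    qed
    finally show "join ?S z w = Mins ?S (Ub ?S {z, w})" using that by (simp add: swap_obj_simps)
    have "Maxs ?S (Lb ?S {z, w}) = {u \<in> swap_carrier L. fst u \<preceq>\<^bsub>L\<^esub> fst z \<and> fst u \<preceq>\<^bsub>L\<^esub> fst w \<and>
        (\<forall>v\<in>swap_carrier L. fst v \<preceq>\<^bsub>L\<^esub> fst z \<and> fst v \<preceq>\<^bsub>L\<^esub> fst w \<longrightarrow> fst v \<preceq>\<^bsub>L\<^esub> fst u)}"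
      using that by (simp add: Maxs_def Lb_def set_le_def le_swap_obj_iff swap_obj_simps
          del: split_paired_All) blast
    also have "\<dots> = {u \<in> swap_carrier L. fst u \<in> meet L (fst z) (fst w)}"
    proof -
      have "(\<forall>v\<in>swap_carrier L. fst v \<preceq>\<^bsub>L\<^esub> fst z \<and> fst v \<preceq>\<^bsub>L\<^esub> fst w \<longrightarrow> fst v \<preceq>\<^bsub>L\<^esub> a) \<longleftrightarrow>
          (\<forall>v. v \<preceq>\<^bsub>L\<^esub> fst z \<and> v \<preceq>\<^bsub>L\<^esub> fst w \<longrightarrow> v \<preceq>\<^bsub>L\<^esub> a)" for a
        using ex_swap_carrier_fst le_carrier(1) by metis
      then show ?thesis by (simp only: mem_meet_iff[OF c])
    qed
    finally show "meet ?S z w = Maxs ?S (Lb ?S {z, w})" using that by (simp add: swap_obj_simps)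
  qed
  ultimately show ?thesis by (simp add: hyperlattice_def swap_obj_simps(1))
qed

lemma swap_obj_ihl: "is_ihl (swap_obj L)"
  unfolding is_ihl_def
proof (intro conjI ballI impI, goal_cases)
  case 1
  show ?case by (rule swap_obj_hyperlattice)
next
  case 2
  show ?case
    using hyperop2_fst_preimage[of "imp L"] hyperop_closed hyperop_nonempty
    by (simp add: swap_obj_def)
next
  case (3 x y z)
  then show ?case
    using imp_elim[of "fst x" "fst y" "fst z"]
    by (auto simp: set_le_def le_swap_obj_iff swap_obj_simps fst_mem_carrier)
next
  case (4 x y z)
  then have c: "x \<in> swap_carrier L" "y \<in> swap_carrier L" "z \<in> swap_carrier L"
    by (simp_all add: swap_obj_simps)
  \<comment> \<open>The hypothesis concerns only pairs in the swap meet, so \<open>v\<close> is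
    first lifted to a pair with first coordinate \<open>v\<close>.\<close>
  have "v \<preceq>\<^bsub>L\<^esub> fst y" if v: "v \<in> meet L (fst x) (fst z)" for v
  proof -
    from v c obtain u where "u \<in> swap_carrier L" "fst u = v"
      using ex_swap_carrier_fst hyperop_closed(1) fst_mem_carrier by (meson subsetD)
    with 4 v c show ?thesis
      by (auto simp: set_le_def le_swap_obj_iff swap_obj_simps simp del: split_paired_All)
  qed
  then show ?case
    using c imp_greatest[of "fst x" "fst y" "fst z"]
    by (auto simp: set_le_def le_swap_obj_iff swap_obj_simps fst_mem_carrier)
next
  case (5 x y z z')
  then show ?case
    using imp_eqv_closed[of "fst x" "fst y" "fst z" "fst z'"]
    by (auto simp: eqv_def le_swap_obj_iff swap_obj_simps fst_mem_carrier)
qed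

lemma swap_obj_hcw: "is_hcw (swap_obj L)"
  unfolding is_hcw_def
proof (intro conjI ballI impI, goal_cases)
  case 1
  show ?case by (rule swap_obj_ihl)
next
  case 2
  \<comment> \<open>The witness is \<open>(snd z, fst z)\<close>, whose second coordinate satisfies
    the inequality by reflexivity.\<close>
  have "{u \<in> swap_carrier L. fst u = snd z \<and> snd u \<preceq>\<^bsub>L\<^esub> fst z} \<noteq> {}" if "z \<in> swap_carrier L" for z
    using swap_mem_swap_carrier[OF that] fst_mem_carrier[OF that] le_refl by force
  then show ?case
    unfolding hyperop1_def swap_obj_def
    by (simp only: proset.simps hyperlattice.simps ihl.simps hcw.simps)
      (intro restrict_PiE_iff[THEN iffD2] ballI, blast)
next
  case (3 x y w)
  \<comment> \<open>Since \<open>fst y = snd x\<close>, the element \<open>fst w\<close> lies in the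
    join of the two coordinates of \<open>x\<close>, which consists of top elements.\<close>
  then have "w \<in> swap_carrier L" "fst w \<in> Top L"
    by (auto simp: swap_obj_simps mem_swap_carrier_iff)
  then show ?case
    by (auto simp: Top_def[of "swap_obj L"] Maxs_def set_le_def le_swap_obj_iff swap_obj_simps
        mem_Top_iff fst_mem_carrier)
next
  case (4 x y w)
  \<comment> \<open>Here \<open>fst w = snd y\<close>, and \<open>snd y\<close> is below
    \<open>fst x\<close> by the inequality in the definition of negation.\<close>
  then show ?case by (auto simp: le_swap_obj_iff swap_obj_simps)
qed

end

section \<open>Morphisms\<close>

lemma ihl_homD:
  assumes "f \<in> ihl_hom L M" "is_ihl L" "x \<in> carrier L" "y \<in> carrier L"
  shows "f x \<in> carrier M"
    and "z \<in> meet L x y \<Longrightarrow> f z \<in> meet M (f x) (f y)"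
    and "z \<in> join L x y \<Longrightarrow> f z \<in> join M (f x) (f y)"
    and "z \<in> imp L x y \<Longrightarrow> f z \<in> imp M (f x) (f y)"
  using assms hyperop_closed[of L x y] unfolding ihl_hom_def by auto

lemma ihl_hom_mono:
  assumes f: "f \<in> ihl_hom L M" and L: "is_ihl L" and M: "is_ihl M" and le: "x \<preceq>\<^bsub>L\<^esub> y"
  shows "f x \<preceq>\<^bsub>M\<^esub> f y"
proof -
  note c = le_carrier[OF L le]
  show ?thesis
    using ihl_homD(1,2)[OF f L] c le le_iff_mem_meet[OF L c] le_iff_mem_meet[OF M, of "f x" "f y"]
    by auto
qed

lemma ihl_hom_Top:
  assumes f: "f \<in> ihl_hom L M" and L: "is_ihl L" and M: "is_ihl M" and t: "t \<in> Top L"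
  shows "f t \<in> Top M"
proof -
  have c: "t \<in> carrier L" using t mem_Top_iff[OF L] by blast
  show ?thesis
    using ihl_homD(1,4)[OF f L c c] t imp_self_eq_Top[OF L c] imp_self_eq_Top[OF M, of "f t"] by auto
qed

text \<open>A morphism sends a chosen \<open>w\<close> in the join of the coordinates to an element
  of the join of their images. That element is top because \<open>w\<close> is, and one such element
  suffices.\<close>

lemma swap_map_closed:
  assumes f: "f \<in> ihl_hom L M" and L: "is_ihl L" and M: "is_ihl M" and z: "z \<in> swap_carrier L"
  shows "(f (fst z), f (snd z)) \<in> swap_carrier M"
proof -
  have c: "fst z \<in> carrier L" "snd z \<in> carrier L" and sub: "join L (fst z) (snd z) \<subseteq> Top L"
    using z mem_swap_carrier_iff[OF L] by auto
  obtain w where w: "w \<in> join L (fst z) (snd z)" using hyperop_nonempty(2)[OF L c] by auto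
  show ?thesis
    using swap_carrier_of_join_meets_Top[OF M] ihl_homD(1)[OF f L] ihl_homD(3)[OF f L c w]
      ihl_hom_Top[OF f L M] c w sub by blast
qed

lemma swap_map_hom:
  assumes f: "f \<in> ihl_hom L M" and L: "is_ihl L" and M: "is_ihl M"
  shows "swap_map L M f \<in> hcw_hom (swap_obj L) (swap_obj M)"
proof -
  note simps = swap_obj_simps[OF L] swap_obj_simps[OF M]
  note hom = ihl_homD[OF f L] ihl_hom_mono[OF f L M]
  note cl = swap_map_closed[OF f L M]
  have "swap_map L M f \<in> ihl_hom (swap_obj L) (swap_obj M)"
    using cl hom fst_mem_carrier[OF L] by (auto simp: ihl_hom_def swap_map_def simps)
  \<comment> \<open>The equation between coordinates survives applying \<open>f\<close>, and the
    inequality survives by monotonicity, which is \<open>hom(5)\<close>.\<close>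
  moreover have "swap_map L M f z \<in> neg (swap_obj M) (swap_map L M f x)"
    if "x \<in> swap_carrier L" "z \<in> neg (swap_obj L) x" for x z
    using that cl[of x] cl[of z] hom(5) by (auto simp: swap_map_def simps)
  ultimately show ?thesis by (simp add: hcw_hom_def simps)
qed

section \<open>Category axioms and functoriality\<close>

lemma ihl_hom_id: "is_ihl L \<Longrightarrow> (\<lambda>x\<in>carrier L. x) \<in> ihl_hom L L"
  using hyperop_closed[of L] by (auto simp: ihl_hom_def)

lemma ihl_hom_compose:
  assumes "is_ihl L" "is_ihl M" "f \<in> ihl_hom L M" "g \<in> ihl_hom M N"
  shows "compose (carrier L) g f \<in> ihl_hom L N"
  using assms(4) ihl_homD[OF assms(3,1)] ihl_homD[OF assms(4,2)]
  by (auto simp: ihl_hom_def compose_def)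

lemma hcw_imp_ihl: "is_hcw H \<Longrightarrow> is_ihl H"
  by (simp add: is_hcw_def)

lemma hcw_hom_imp_ihl_hom: "f \<in> hcw_hom H K \<Longrightarrow> f \<in> ihl_hom H K"
  by (simp add: hcw_hom_def)

lemma hcw_hom_id: "is_hcw H \<Longrightarrow> (\<lambda>x\<in>carrier H. x) \<in> hcw_hom H H"
  using ihl_hom_id[OF hcw_imp_ihl] by (auto simp: hcw_hom_def)

lemma hcw_hom_compose:
  assumes "is_hcw H" "is_hcw K" "f \<in> hcw_hom H K" "g \<in> hcw_hom K N"
  shows "compose (carrier H) g f \<in> hcw_hom H N"
  using assms ihl_hom_compose[of H K f g N] ihl_homD(1)[of f H K]
  by (auto simp: hcw_hom_def hcw_imp_ihl compose_def)

lemma ihl_hom_PiE: "f \<in> ihl_hom L M \<Longrightarrow> f \<in> carrier L \<rightarrow>\<^sub>E carrier M"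
  by (simp add: ihl_hom_def)

text \<open>Equality holds as total functions: outside \<open>A\<close>, both sides take the value
  \<open>undefined\<close>, by extensionality of \<open>f\<close>.\<close>

lemma compose_restrict_id:
  assumes "f \<in> A \<rightarrow>\<^sub>E B"
  shows "compose A f (\<lambda>x\<in>A. x) = f" "compose A (\<lambda>x\<in>B. x) f = f"
  using assms by (auto simp: compose_def fun_eq_iff PiE_iff extensional_def)

lemma compose_compose:
  assumes "f \<in> A \<rightarrow>\<^sub>E B"
  shows "compose A h (compose A g f) = compose A (compose B h g) f"
  using assms by (auto simp: compose_def fun_eq_iff PiE_iff)

lemma category_IHL: "category IHL"
  by unfold_locales
    (auto simp: IHL_def ihl_hom_id ihl_hom_compose
      intro: compose_restrict_id[OF ihl_hom_PiE] compose_compose[OF ihl_hom_PiE])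

lemma category_HCwA: "category HCwA"
  by unfold_locales
    (auto simp: HCwA_def hcw_hom_id hcw_hom_compose
      intro: compose_restrict_id[OF ihl_hom_PiE[OF hcw_hom_imp_ihl_hom]]
        compose_compose[OF ihl_hom_PiE[OF hcw_hom_imp_ihl_hom]])

lemma swap_map_id:
  "is_ihl L \<Longrightarrow> swap_map L L (\<lambda>x\<in>carrier L. x) = (\<lambda>z\<in>carrier (swap_obj L). z)"
  by (auto simp: swap_map_def fun_eq_iff swap_obj_simps mem_swap_carrier_iff)

text \<open>Composition is coordinatewise; \<open>swap_map_closed\<close> puts the intermediate pair
  into \<open>swap_carrier M\<close>, where the restriction built into \<open>swap_map M N g\<close>
  has no effect.\<close>

lemma swap_map_compose:
  assumes "is_ihl L" "is_ihl M" "f \<in> ihl_hom L M"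
  shows "swap_map L N (compose (carrier L) g f) =
    compose (carrier (swap_obj L)) (swap_map M N g) (swap_map L M f)"
  using assms swap_map_closed[OF assms(3,1,2)]
  by (auto simp: swap_map_def fun_eq_iff swap_obj_simps mem_swap_carrier_iff[OF assms(1)] compose_def)

theorem theorem5p4:
  "cat_functor (IHL :: ('a ihl, 'a \<Rightarrow> 'a) cat) (HCwA :: (('a \<times> 'a) hcw, 'a \<times> 'a \<Rightarrow> 'a \<times> 'a) cat)
     swap_obj swap_map"
proof (intro cat_functor.intro cat_functor_axioms.intro category_IHL category_HCwA)
qed (auto simp: IHL_def HCwA_def swap_obj_hcw swap_map_hom swap_map_id swap_map_compose)

end
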